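(* Let $\mathcal{R}=\{c_1,\dots,c_r\}$ be a finite set of rankings of the nodes $\mathcal{N}=\{1,\dots,n\}$. For natural numbers $p\le q$ in $\{1,\dots,n\}$ put $$D_{[p,q]}=\{x\in\mathcal{N}\ :\ c_s^{-1}(x)\in[p,q]\text{ for some }c_s\in\mathcal{R}\}.$$ Then every set of eventual competitors $D$ (with respect to $\mathcal{R}$) is of the form $D=D_{[p,q]}$ for some closed interval $[p,q]$ of natural numbers; moreover $p$ and $q$ are the first (leftmost) and last (rightmost) positions of the elements of $D_{[p,q]}$ with respect to all rankings, i.e. $$p=\min\{c_s^{-1}(x): x\in D_{[p,q]},\ c_s\in\mathcal{R}\},\qquad q=\max\{c_s^{-1}(x): x\in D_{[p,q]},\ c_s\in\mathcal{R}\}.$$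
   Context: Let $n\ge1$ and $\mathcal{N}=\{1,\dots,n\}$. A ranking of $\mathcal{N}$ is a bijection $c:\mathcal{N}\to\mathcal{N}$, identified with the vector $(c(1),\dots,c(n))$, so that $c^{-1}(i)$ is the position of node $i$ in the ranking. Write $i\prec_c j$ if $c^{-1}(i)<c^{-1}(j)$, i.e. $i$ appears before $j$ in the vector. Given a finite nonempty set $\mathcal{R}=\{c_1,\dots,c_r\}$ of rankings of $\mathcal{N}$, nodes $i,j$ compete if there exist $c_s,c_t\in\mathcal{R}$ with $i\prec_{c_s}j$ and $j\prec_{c_t}i$. The competitivity graph $G_c(\mathcal{R})$ is the undirected graph on $\mathcal{N}$ in which $i,j$ are adjacent iff they compete. Two nodes eventually compete if they are connected by a finite chain of nodes in which consecutive nodes compete, i.e. by a path in $G_c(\mathcal{R})$. A set of eventual competitors is a maximal set of nodes with respect to the property of eventual competition among its elements; equivalently, the sets of eventual competitors are the connected components of $G_c(\mathcal{R})$ (an isolated vertex forms a singleton set of eventual competitors). *)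

theory Defs
  imports "HOL-Combinatorics.Permutations"
begin

text \<open>
  A ranking is a permutation \<open>c\<close> of \<open>{1..n}\<close>, read as the vector \<open>(c 1, \<dots>, c n)\<close>: \<open>c k\<close> is the
  node at position \<open>k\<close>, so the position of node \<open>i\<close> is \<open>inv c i\<close>. With \<open>permutes\<close>, distinct
  functions are distinct rankings, and \<open>inv c\<close> agrees on \<open>{1..n}\<close> with the inverse of the
  bijection of \<open>{1..n}\<close>.
\<close>

definition ranking :: "nat \<Rightarrow> (nat \<Rightarrow> nat) \<Rightarrow> bool" where
  "ranking n c \<longleftrightarrow> c permutes {1..n}"

definition precedes :: "(nat \<Rightarrow> nat) \<Rightarrow> nat \<Rightarrow> nat \<Rightarrow> bool" where
  "precedes c i j \<longleftrightarrow> inv c i < inv c j"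

definition compete :: "(nat \<Rightarrow> nat) set \<Rightarrow> nat \<Rightarrow> nat \<Rightarrow> bool" where
  "compete R i j \<longleftrightarrow> (\<exists>s\<in>R. \<exists>t\<in>R. precedes s i j \<and> precedes t j i)"

text \<open>The adjacency relation of the competitivity graph on the vertex set \<open>{1..n}\<close>.\<close>

definition competitivity_graph :: "nat \<Rightarrow> (nat \<Rightarrow> nat) set \<Rightarrow> (nat \<times> nat) set" where
  "competitivity_graph n R = {(i, j). i \<in> {1..n} \<and> j \<in> {1..n} \<and> compete R i j}"

text \<open>
  Chains may have length zero, so every node eventually competes with itself; this is what makes
  an isolated vertex a singleton set of eventual competitors.
\<close>

definition eventually_compete :: "nat \<Rightarrow> (nat \<Rightarrow> nat) set \<Rightarrow> nat \<Rightarrow> nat \<Rightarrow> bool" where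
  "eventually_compete n R i j \<longleftrightarrow>
     i \<in> {1..n} \<and> j \<in> {1..n} \<and> (i, j) \<in> (competitivity_graph n R)\<^sup>*"

definition mutual_eventual_competitors :: "nat \<Rightarrow> (nat \<Rightarrow> nat) set \<Rightarrow> nat set \<Rightarrow> bool" where
  "mutual_eventual_competitors n R D \<longleftrightarrow>
     D \<subseteq> {1..n} \<and> (\<forall>i\<in>D. \<forall>j\<in>D. eventually_compete n R i j)"

definition set_of_eventual_competitors :: "nat \<Rightarrow> (nat \<Rightarrow> nat) set \<Rightarrow> nat set \<Rightarrow> bool" where
  "set_of_eventual_competitors n R D \<longleftrightarrow>
     mutual_eventual_competitors n R D \<and>
     (\<forall>D'. mutual_eventual_competitors n R D' \<and> D \<subseteq> D' \<longrightarrow> D' = D)"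

definition D_interval :: "nat \<Rightarrow> (nat \<Rightarrow> nat) set \<Rightarrow> nat \<Rightarrow> nat \<Rightarrow> nat set" where
  "D_interval n R p q = {x \<in> {1..n}. \<exists>c\<in>R. inv c x \<in> {p..q}}"

end

theory Submission
  imports Defs
begin

text \<open>
  Let \<open>y\<close> be a node outside a set \<open>D\<close> of eventual competitors. Then \<open>y\<close> competes with no
  element of \<open>D\<close>, so each element of \<open>D\<close> is on the same side of \<open>y\<close> in all rankings. This side
  is moreover the same for any two competing \<open>x, z\<close> in \<open>D\<close>: if \<open>y\<close> precedes \<open>x\<close>, then in a
  ranking that puts \<open>x\<close> before \<open>z\<close> it precedes \<open>z\<close> as well. As \<open>D\<close> is connected by chains of
  competitors, \<open>y\<close> precedes all of \<open>D\<close> in all rankings or follows all of \<open>D\<close> in all rankings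
  (\<open>outsider_on_one_side\<close>).

  Hence the set \<open>B\<close> of the nodes before \<open>D\<close> does not depend on the ranking. Every ranking lists
  \<open>B\<close> first, then \<open>D\<close>, then the rest, so in every ranking \<open>D\<close> occupies exactly the positions
  from \<open>p = card B + 1\<close> to \<open>q = card B + card D\<close> (\<open>positions_of_eventual_competitors\<close>). The
  theorem follows because a node with a position in \<open>[p, q]\<close> in a single ranking must then
  belong to \<open>D\<close>.
\<close>

section \<open>Positions in a ranking\<close>

lemma position_permutes:
  assumes "ranking n c"
  shows "inv c permutes {1..n}"
  using assms by (simp add: ranking_def permutes_inv)

lemma position_eq_iff:
  assumes "ranking n c"
  shows "inv c x = inv c y \<longleftrightarrow> x = y"
  using position_permutes[OF assms] by (simp add: permutes_inj inj_eq)

lemma position_in_iff: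
  assumes "ranking n c"
  shows "inv c x \<in> {1..n} \<longleftrightarrow> x \<in> {1..n}"
  using position_permutes[OF assms] by (rule permutes_in_image)

section \<open>Nodes outside a set of eventual competitors\<close>

lemma compete_sym:
  assumes "compete R x y"
  shows "compete R y x"
  using assms unfolding compete_def by blast

lemma eventually_compete_sym:
  assumes "eventually_compete n R x y"
  shows "eventually_compete n R y x"
proof -
  have "sym (competitivity_graph n R)"
    unfolding sym_def competitivity_graph_def using compete_sym by blast
  then show ?thesis
    using assms unfolding eventually_compete_def by (meson sym_rtrancl symD)
qed

lemma eventually_compete_trans:
  assumes "eventually_compete n R x y" and "eventually_compete n R y z"
  shows "eventually_compete n R x z"
  using assms unfolding eventually_compete_def by (meson rtrancl_trans)

text \<open>
  This is what the maximality in the definition is for: adding to \<open>D\<close> a competitor of one of its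
  elements keeps all elements mutually reachable.
\<close>

lemma competitor_in_set_of_eventual_competitors:
  assumes D: "set_of_eventual_competitors n R D"
    and x: "x \<in> D" and y: "y \<in> {1..n}" and xy: "compete R x y"
  shows "y \<in> D"
proof -
  have sub: "D \<subseteq> {1..n}"
    and conn: "\<And>u v. u \<in> D \<Longrightarrow> v \<in> D \<Longrightarrow> eventually_compete n R u v"
    using D unfolding set_of_eventual_competitors_def mutual_eventual_competitors_def by blast+
  have "eventually_compete n R x y"
    using x y xy sub unfolding eventually_compete_def competitivity_graph_def by blast
  then have to_y: "eventually_compete n R u y" if "u \<in> D" for u
    using conn[OF that x] eventually_compete_trans by blast
  have "eventually_compete n R y y"
    using y unfolding eventually_compete_def by simp
  then have "mutual_eventual_competitors n R (insert y D)"
    unfolding mutual_eventual_competitors_def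
    using sub y conn to_y eventually_compete_sym by blast
  then have "insert y D = D"
    using D unfolding set_of_eventual_competitors_def by blast
  then show ?thesis by blast
qed

text \<open>The empty set is not maximal, since a single node is mutually reachable with itself.\<close>

lemma set_of_eventual_competitors_nonempty:
  assumes "n \<ge> 1" and "set_of_eventual_competitors n R D"
  shows "D \<noteq> {}"
proof
  assume "D = {}"
  moreover have "mutual_eventual_competitors n R {1}"
    using \<open>n \<ge> 1\<close> by (simp add: mutual_eventual_competitors_def eventually_compete_def)
  ultimately show False
    using assms(2) unfolding set_of_eventual_competitors_def by blast
qed

text \<open>
  The statement speaks of two elements of \<open>D\<close> and two rankings at once because the two ways of
  transporting ``\<open>y\<close> comes first'' feed each other: passing to a competitor is possible only in a
  ranking of a suitable order, and passing to another ranking only for nodes of \<open>D\<close>, with which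
  \<open>y\<close> does not compete.
\<close>

lemma outsider_on_one_side:
  assumes R: "\<forall>c\<in>R. ranking n c" and D: "set_of_eventual_competitors n R D"
    and y: "y \<in> {1..n}" "y \<notin> D"
    and x: "x \<in> D" and z: "z \<in> D" and s: "s \<in> R" and t: "t \<in> R"
    and before: "precedes s y x"
  shows "precedes t y z"
proof -
  have all: "\<forall>c\<in>R. precedes c y w" if w: "w \<in> D" "c' \<in> R" "precedes c' y w" for w c'
  proof
    fix c assume c: "c \<in> R"
    have "\<not> compete R w y"
      using competitor_in_set_of_eventual_competitors[OF D w(1) y(1)] y(2) by blast
    then have "\<not> precedes c w y"
      using c w unfolding compete_def by blast
    moreover have "inv c w \<noteq> inv c y"
      using position_eq_iff[of n c w y] R c w(1) y(2) by blast
    ultimately show "precedes c y w"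
      unfolding precedes_def by linarith
  qed
  have "(x, z) \<in> (competitivity_graph n R)\<^sup>*"
    using D x z
    unfolding set_of_eventual_competitors_def mutual_eventual_competitors_def
      eventually_compete_def by blast
  then have "z \<in> D \<and> (\<forall>c\<in>R. precedes c y z)"
  proof (induction rule: rtrancl_induct)
    case base
    show ?case using all[OF x s before] x by blast
  next
    case (step v w)
    then have vw: "compete R v w" and "w \<in> {1..n}"
      unfolding competitivity_graph_def by auto
    then have w: "w \<in> D"
      using competitor_in_set_of_eventual_competitors[OF D] step.IH by blast
    obtain c where c: "c \<in> R" "precedes c v w"
      using vw unfolding compete_def by blast
    then have "precedes c y w"
      using step.IH unfolding precedes_def by (meson less_trans)
    then show ?case using all[OF w c(1)] w by blast
  qed
  then show ?thesis using t by blast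
qed

section \<open>Initial segments of rankings\<close>

lemma down_closed_eq_atLeastAtMost_card:
  fixes S :: "nat set"
  assumes fin: "finite S" and pos: "\<And>k. k \<in> S \<Longrightarrow> 1 \<le> k"
    and down: "\<And>j k. k \<in> S \<Longrightarrow> 1 \<le> j \<Longrightarrow> j < k \<Longrightarrow> j \<in> S"
  shows "S = {1..card S}"
proof (cases "S = {}")
  case False
  have "S = {1..Max S}"
  proof
    show "S \<subseteq> {1..Max S}" using fin pos by auto
    show "{1..Max S} \<subseteq> S"
    proof
      fix j assume "j \<in> {1..Max S}"
      then show "j \<in> S"
        using down[OF Max_in[OF fin False], of j] Max_in[OF fin False] by (cases "j = Max S") auto
    qed
  qed
  then show ?thesis by (metis card_atLeastAtMost diff_Suc_1)
qed simp

lemma positions_of_initial_set: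
  assumes c: "ranking n c" and S: "S \<subseteq> {1..n}"
    and initial: "\<And>u v. u \<in> S \<Longrightarrow> v \<in> {1..n} \<Longrightarrow> precedes c v u \<Longrightarrow> v \<in> S"
  shows "inv c ` S = {1..card S}"
proof -
  note perm = position_permutes[OF c]
  have "inv c ` S = {1..card (inv c ` S)}"
  proof (rule down_closed_eq_atLeastAtMost_card)
    show "finite (inv c ` S)"
      using S finite_subset by blast
  next
    fix k assume "k \<in> inv c ` S"
    then show "1 \<le> k"
      using S position_in_iff[OF c] by fastforce
  next
    fix j k assume k: "k \<in> inv c ` S" and j: "1 \<le> j" "j < k"
    then obtain u where u: "u \<in> S" "k = inv c u" by blast
    then have "k \<in> {1..n}"
      using S position_in_iff[OF c, of u] by blast
    then have "j \<in> {1..n}" using j by simp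
    then obtain v where v: "v \<in> {1..n}" "j = inv c v"
      using permutes_image[OF perm] by blast
    then show "j \<in> inv c ` S"
      using initial[OF u(1) v(1)] u(2) j(2) unfolding precedes_def by blast
  qed
  moreover have "card (inv c ` S) = card S"
    using permutes_inj_on[OF perm] by (rule card_image)
  ultimately show ?thesis by simp
qed

text \<open>
  With \<open>B\<close> the set of the nodes that precede \<open>D\<close> in all rankings, both \<open>B\<close> and \<open>B \<union> D\<close> are
  initial in every ranking, so that \<open>D\<close> fills the gap between their lengths. That the offset \<open>b\<close>
  is independent of the ranking is the point of the lemma.
\<close>

lemma positions_of_eventual_competitors:
  assumes R: "\<forall>c\<in>R. ranking n c" and D: "set_of_eventual_competitors n R D"
    and ne: "D \<noteq> {}"
  shows "\<exists>b. \<forall>c\<in>R. inv c ` D = {b + 1..b + card D}"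
proof -
  define B where "B = {y \<in> {1..n}. \<forall>c\<in>R. \<forall>x\<in>D. precedes c y x}"
  have sub: "D \<subseteq> {1..n}"
    using D unfolding set_of_eventual_competitors_def mutual_eventual_competitors_def by blast
  have "inv c ` D = {card B + 1..card B + card D}" if c: "c \<in> R" for c
  proof -
    have rank: "ranking n c" using R c by blast
    have disj: "B \<inter> D = {}"
      using c unfolding B_def precedes_def by blast
    have in_B: "v \<in> B" if "v \<in> {1..n}" "v \<notin> D" "u \<in> D" "precedes c v u" for u v
      using that outsider_on_one_side[OF R D that(1,2,3) _ c _ that(4)] unfolding B_def by blast
    have B: "inv c ` B = {1..card B}"
    proof (rule positions_of_initial_set[OF rank])
      show "B \<subseteq> {1..n}" unfolding B_def by blast
    next
      fix u v assume u: "u \<in> B" and v: "v \<in> {1..n}" "precedes c v u"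
      then have before: "\<forall>x\<in>D. precedes c v x"
        using c unfolding B_def precedes_def by fastforce
      then have "v \<notin> D" unfolding precedes_def by blast
      then show "v \<in> B" using in_B v(1) before ne by blast
    qed
    have "inv c ` (B \<union> D) = {1..card (B \<union> D)}"
    proof (rule positions_of_initial_set[OF rank])
      show "B \<union> D \<subseteq> {1..n}" using sub unfolding B_def by blast
    next
      fix u v assume u: "u \<in> B \<union> D" and v: "v \<in> {1..n}" "precedes c v u"
      obtain x where "x \<in> D" "precedes c v x"
      proof (cases "u \<in> D")
        case True
        then show ?thesis using that v by blast
      next
        case False
        obtain x where "x \<in> D" using ne by blast
        moreover have "precedes c u x"
          using False u c \<open>x \<in> D\<close> unfolding B_def by blast
        ultimately show ?thesis
          using that v unfolding precedes_def by (meson less_trans)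
      qed
      then show "v \<in> B \<union> D" using in_B v(1) by blast
    qed
    moreover have "card (B \<union> D) = card B + card D"
      using disj sub by (intro card_Un_disjoint) (auto simp: B_def intro: finite_subset)
    ultimately have BD: "inv c ` (B \<union> D) = {1..card B + card D}" by simp
    have "D = (B \<union> D) - B" using disj by blast
    then have "inv c ` D = inv c ` ((B \<union> D) - B)" by simp
    also have "\<dots> = inv c ` (B \<union> D) - inv c ` B"
      using permutes_inj[OF position_permutes[OF rank]] by (rule image_set_diff)
    also have "\<dots> = {card B + 1..card B + card D}"
      unfolding B BD by auto
    finally show ?thesis .
  qed
  then show ?thesis by blast
qed

section \<open>Sets of eventual competitors are intervals\<close>

theorem theorem4p3:
  fixes n :: nat and R :: "(nat \<Rightarrow> nat) set" and D :: "nat set"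
  assumes "n \<ge> 1"
    and "finite R" and "R \<noteq> {}" and "\<forall>c\<in>R. ranking n c"
    and "set_of_eventual_competitors n R D"
  shows "\<exists>p q. 1 \<le> p \<and> p \<le> q \<and> q \<le> n \<and> D = D_interval n R p q \<and>
    p = Min {inv c x | c x. c \<in> R \<and> x \<in> D_interval n R p q} \<and>
    q = Max {inv c x | c x. c \<in> R \<and> x \<in> D_interval n R p q}"
proof -
  note R = \<open>\<forall>c\<in>R. ranking n c\<close> and D = \<open>set_of_eventual_competitors n R D\<close>
  have sub: "D \<subseteq> {1..n}"
    using D unfolding set_of_eventual_competitors_def mutual_eventual_competitors_def by blast
  have ne: "D \<noteq> {}"
    using set_of_eventual_competitors_nonempty[OF \<open>n \<ge> 1\<close> D] .
  obtain b where b: "\<forall>c\<in>R. inv c ` D = {b + 1..b + card D}"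
    using positions_of_eventual_competitors[OF R D ne] by blast
  define p q where "p = b + 1" and "q = b + card D"
  have img: "inv c ` D = {p..q}" if "c \<in> R" for c
    using b that unfolding p_def q_def by blast
  have "card D > 0"
    using ne sub by (meson card_gt_0_iff finite_atLeastAtMost finite_subset)
  then have pq: "1 \<le> p" "p \<le> q"
    unfolding p_def q_def by auto
  obtain c where c: "c \<in> R" using \<open>R \<noteq> {}\<close> by blast
  have "inv c ` D \<subseteq> {1..n}"
    using sub position_in_iff[of n c] R c by blast
  then have "q \<le> n"
    using pq img[OF c] by auto
  have interval: "D = D_interval n R p q"
  proof
    show "D \<subseteq> D_interval n R p q"
      unfolding D_interval_def using sub img[OF c] c by blast
    show "D_interval n R p q \<subseteq> D"
    proof
      fix x assume "x \<in> D_interval n R p q"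
      then obtain s where s: "s \<in> R" "inv s x \<in> inv s ` D"
        unfolding D_interval_def using img by blast
      then obtain y where y: "y \<in> D" "inv s x = inv s y" by blast
      have "ranking n s" using R s(1) by blast
      then have "x = y" using position_eq_iff y(2) by blast
      then show "x \<in> D" using y(1) by simp
    qed
  qed
  have "{inv c x | c x. c \<in> R \<and> x \<in> D} = (\<Union>c\<in>R. inv c ` D)" by blast
  also have "\<dots> = {p..q}" using img \<open>R \<noteq> {}\<close> by simp
  finally have positions: "{inv c x | c x. c \<in> R \<and> x \<in> D_interval n R p q} = {p..q}"
    unfolding interval[symmetric] .
  have "p = Min {p..q}" "q = Max {p..q}"
    using pq(2) by (auto intro!: Min_eqI[symmetric] Max_eqI[symmetric])
  then show ?thesis
    unfolding positions[symmetric] using pq \<open>q \<le> n\<close> interval by blast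
qed

end
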